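(* Let $X_\tau$ be a site with a final object $X$, $A$ an abelian sheaf on $X_\tau$, $G$ a finite group, and $y$ an $A$-torsor on $X$ with an action of $G$ given by morphisms $\{\lambda_g\}_{g\in G}$. Then the associated $2$-cochain $\chi_\lambda$ with values in $A(X)$ is a $2$-cocycle (with respect to the underlying action of $G$ on $A(X)$).
   Context: Abelian sheaves are written additively. An $A$-torsor is a sheaf of sets $y$ on $X_\tau$ with an action $A\times y\to y$ such that $A(U)$ acts simply transitively on $y(U)$ whenever $y(U)\neq\emptyset$, and every object $U$ has a cover $\{U_i\to U\}$ with all $y(U_i)\ne\emptyset$. An action of $G$ on $y$ is a family of morphisms of sheaves $\lambda_g:y\to y$ ($g\in G$) such that each $\lambda_g$ is equivariant with respect to an automorphism $\phi_g:A\to A$ of abelian sheaves, i.e. $\lambda_g(a\cdot x)=\phi_g(a)\cdot\lambda_g(x)$, and the $\phi_g$ form a left action of $G$ on $A$: $\phi_{gh}=\phi_g\circ\phi_h$ (the underlying action). No condition $\lambda_{gh}=\lambda_g\circ\lambda_h$ is imposed. The cochain $\chi_\lambda$ is defined by $\lambda_g\circ\lambda_h=\chi_\lambda(g,h)\cdot\lambda_{gh}$ with $\chi_\lambda(g,h)\in A(X)$. *)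

theory Defs
  imports "HOL-Algebra.Group"
begin

record ('o, 'm) category =
  Ob :: "'o set"
  Ar :: "'m set"
  Dom :: "'m \<Rightarrow> 'o"
  Cod :: "'m \<Rightarrow> 'o"
  Id :: "'o \<Rightarrow> 'm"
  Comp :: "'m \<Rightarrow> 'm \<Rightarrow> 'm"

definition Hom :: "('o, 'm, 'z) category_scheme \<Rightarrow> 'o \<Rightarrow> 'o \<Rightarrow> 'm set"
  where "Hom C U V = {f \<in> Ar C. Dom C f = U \<and> Cod C f = V}"

text \<open>Composition is in functional order: \<open>Comp C g f\<close> is "first \<open>f\<close>, then \<open>g\<close>".\<close>

locale category =
  fixes C :: "('o, 'm, 'z) category_scheme"
  assumes dom_closed: "f \<in> Ar C \<Longrightarrow> Dom C f \<in> Ob C"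
    and cod_closed: "f \<in> Ar C \<Longrightarrow> Cod C f \<in> Ob C"
    and id_closed: "U \<in> Ob C \<Longrightarrow> Id C U \<in> Hom C U U"
    and comp_closed: "f \<in> Hom C U V \<Longrightarrow> g \<in> Hom C V W \<Longrightarrow> Comp C g f \<in> Hom C U W"
    and id_left: "f \<in> Hom C U V \<Longrightarrow> Comp C (Id C V) f = f"
    and id_right: "f \<in> Hom C U V \<Longrightarrow> Comp C f (Id C U) = f"
    and comp_assoc: "f \<in> Hom C U V \<Longrightarrow> g \<in> Hom C V W \<Longrightarrow> h \<in> Hom C W Z
      \<Longrightarrow> Comp C h (Comp C g f) = Comp C (Comp C h g) f"

definition final_object :: "('o, 'm, 'z) category_scheme \<Rightarrow> 'o \<Rightarrow> bool"
  where "final_object C X \<longleftrightarrow> X \<in> Ob C \<and> (\<forall>U\<in>Ob C. \<exists>!f. f \<in> Hom C U X)"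

definition iso_arrow :: "('o, 'm, 'z) category_scheme \<Rightarrow> 'm \<Rightarrow> bool"
  where "iso_arrow C f \<longleftrightarrow> f \<in> Ar C \<and>
    (\<exists>g \<in> Hom C (Cod C f) (Dom C f).
       Comp C g f = Id C (Dom C f) \<and> Comp C f g = Id C (Cod C f))"

definition commuting_square ::
    "('o, 'm, 'z) category_scheme \<Rightarrow> 'm \<Rightarrow> 'm \<Rightarrow> 'm \<Rightarrow> 'm \<Rightarrow> bool"
  where "commuting_square C f g p q \<longleftrightarrow>
    f \<in> Ar C \<and> g \<in> Ar C \<and> p \<in> Ar C \<and> q \<in> Ar C \<and>
    Cod C f = Cod C g \<and> Dom C p = Dom C q \<and> Cod C p = Dom C f \<and> Cod C q = Dom C g \<and>
    Comp C f p = Comp C g q"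

text \<open>\<open>p\<close> and \<open>q\<close> are the projections of a fibre product of \<open>f\<close> and \<open>g\<close>
  onto the domains of \<open>f\<close> and \<open>g\<close>.\<close>

definition is_pullback ::
    "('o, 'm, 'z) category_scheme \<Rightarrow> 'm \<Rightarrow> 'm \<Rightarrow> 'm \<Rightarrow> 'm \<Rightarrow> bool"
  where "is_pullback C f g p q \<longleftrightarrow> commuting_square C f g p q \<and>
    (\<forall>p' q'. commuting_square C f g p' q' \<longrightarrow>
      (\<exists>!h. h \<in> Hom C (Dom C p') (Dom C p) \<and> Comp C p h = p' \<and> Comp C q h = q'))"

text \<open>A site is a category with a Grothendieck pretopology. A covering
  \<open>{U\<^sub>i \<rightarrow> U}\<close> is encoded as a set of arrows with codomain \<open>U\<close>; the empty set is not
  excluded. Since fibre products are only determined up to isomorphism, stability under base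
  change is required for every choice of fibre products.\<close>

record ('o, 'm) site = "('o, 'm) category" +
  Cov :: "'o \<Rightarrow> 'm set set"

locale site = category S
  for S :: "('o, 'm, 'z) site_scheme" +
  assumes cov_arrows: "U \<in> Ob S \<Longrightarrow> R \<in> Cov S U \<Longrightarrow> f \<in> R \<Longrightarrow> f \<in> Ar S \<and> Cod S f = U"
    and cov_iso: "iso_arrow S f \<Longrightarrow> {f} \<in> Cov S (Cod S f)"
    and cov_pullback_ex: "U \<in> Ob S \<Longrightarrow> R \<in> Cov S U \<Longrightarrow> g \<in> Hom S V U \<Longrightarrow> f \<in> R
      \<Longrightarrow> \<exists>p q. is_pullback S f g p q"
    and cov_pullback: "U \<in> Ob S \<Longrightarrow> R \<in> Cov S U \<Longrightarrow> g \<in> Hom S V U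
      \<Longrightarrow> (\<And>f. f \<in> R \<Longrightarrow> is_pullback S f g (p f) (q f)) \<Longrightarrow> q ` R \<in> Cov S V"
    and cov_comp: "U \<in> Ob S \<Longrightarrow> R \<in> Cov S U
      \<Longrightarrow> (\<And>f. f \<in> R \<Longrightarrow> T f \<in> Cov S (Dom S f))
      \<Longrightarrow> {Comp S f h |f h. f \<in> R \<and> h \<in> T f} \<in> Cov S U"

record ('o, 'm, 'y) presheaf =
  Sec :: "'o \<Rightarrow> 'y set"
  Res :: "'m \<Rightarrow> 'y \<Rightarrow> 'y"

locale presheaf =
  fixes C :: "('o, 'm, 'z) category_scheme" and F :: "('o, 'm, 'y) presheaf"
  assumes res_closed: "f \<in> Hom C U V \<Longrightarrow> x \<in> Sec F V \<Longrightarrow> Res F f x \<in> Sec F U"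
    and res_id: "U \<in> Ob C \<Longrightarrow> x \<in> Sec F U \<Longrightarrow> Res F (Id C U) x = x"
    and res_comp: "f \<in> Hom C U V \<Longrightarrow> g \<in> Hom C V W \<Longrightarrow> x \<in> Sec F W
      \<Longrightarrow> Res F (Comp C g f) x = Res F f (Res F g x)"

definition compatible_family ::
    "('o, 'm, 'z) category_scheme \<Rightarrow> ('o, 'm, 'y) presheaf \<Rightarrow> 'm set \<Rightarrow> ('m \<Rightarrow> 'y) \<Rightarrow> bool"
  where "compatible_family C F R s \<longleftrightarrow> (\<forall>f\<in>R. s f \<in> Sec F (Dom C f)) \<and>
    (\<forall>f\<in>R. \<forall>g\<in>R. \<forall>p q. is_pullback C f g p q \<longrightarrow> Res F p (s f) = Res F q (s g))"

locale sheaf = presheaf S F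
  for S :: "('o, 'm, 'z) site_scheme" and F :: "('o, 'm, 'y) presheaf" +
  assumes glue: "U \<in> Ob S \<Longrightarrow> R \<in> Cov S U \<Longrightarrow> compatible_family S F R s
    \<Longrightarrow> \<exists>!t. t \<in> Sec F U \<and> (\<forall>f\<in>R. Res F f t = s f)"

definition sheaf_morphism ::
    "('o, 'm, 'z) category_scheme \<Rightarrow> ('o, 'm, 'y) presheaf \<Rightarrow> ('o, 'm, 'w) presheaf
      \<Rightarrow> ('o \<Rightarrow> 'y \<Rightarrow> 'w) \<Rightarrow> bool"
  where "sheaf_morphism C F F' t \<longleftrightarrow>
    (\<forall>U\<in>Ob C. \<forall>x\<in>Sec F U. t U x \<in> Sec F' U) \<and>
    (\<forall>f\<in>Ar C. \<forall>x\<in>Sec F (Cod C f). Res F' f (t (Cod C f) x) = t (Dom C f) (Res F f x))"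

text \<open>The groups \<open>Grp A U\<close> are commutative, but written multiplicatively as everywhere in
  \<open>HOL-Algebra\<close>.\<close>

record ('o, 'm, 'a) ab_presheaf =
  Grp :: "'o \<Rightarrow> 'a monoid"
  ARes :: "'m \<Rightarrow> 'a \<Rightarrow> 'a"

definition underlying :: "('o, 'm, 'a) ab_presheaf \<Rightarrow> ('o, 'm, 'a) presheaf"
  where "underlying A = \<lparr>Sec = (\<lambda>U. carrier (Grp A U)), Res = ARes A\<rparr>"

locale abelian_sheaf = sheaf S "underlying A"
  for S :: "('o, 'm, 'z) site_scheme" and A :: "('o, 'm, 'a) ab_presheaf" +
  assumes grp: "U \<in> Ob S \<Longrightarrow> comm_group (Grp A U)"
    and res_hom: "f \<in> Hom S U V \<Longrightarrow> ARes A f \<in> hom (Grp A V) (Grp A U)"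

definition ab_sheaf_morphism ::
    "('o, 'm, 'z) category_scheme \<Rightarrow> ('o, 'm, 'a) ab_presheaf \<Rightarrow> ('o, 'm, 'b) ab_presheaf
      \<Rightarrow> ('o \<Rightarrow> 'a \<Rightarrow> 'b) \<Rightarrow> bool"
  where "ab_sheaf_morphism C A B t \<longleftrightarrow>
    sheaf_morphism C (underlying A) (underlying B) t \<and>
    (\<forall>U\<in>Ob C. t U \<in> hom (Grp A U) (Grp B U))"

definition ab_sheaf_automorphism ::
    "('o, 'm, 'z) category_scheme \<Rightarrow> ('o, 'm, 'a) ab_presheaf \<Rightarrow> ('o \<Rightarrow> 'a \<Rightarrow> 'a) \<Rightarrow> bool"
  where "ab_sheaf_automorphism C A t \<longleftrightarrow> ab_sheaf_morphism C A A t \<and>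
    (\<exists>s. ab_sheaf_morphism C A A s \<and>
      (\<forall>U\<in>Ob C. \<forall>a\<in>carrier (Grp A U). s U (t U a) = a \<and> t U (s U a) = a))"

locale torsor = A: abelian_sheaf S A + Y: sheaf S Y
  for S :: "('o, 'm, 'z) site_scheme" and A :: "('o, 'm, 'a) ab_presheaf"
    and Y :: "('o, 'm, 'y) presheaf" +
  fixes act :: "'o \<Rightarrow> 'a \<Rightarrow> 'y \<Rightarrow> 'y"
  assumes act_closed: "U \<in> Ob S \<Longrightarrow> a \<in> carrier (Grp A U) \<Longrightarrow> x \<in> Sec Y U \<Longrightarrow> act U a x \<in> Sec Y U"
    and act_natural: "f \<in> Hom S U V \<Longrightarrow> a \<in> carrier (Grp A V) \<Longrightarrow> x \<in> Sec Y V
      \<Longrightarrow> Res Y f (act V a x) = act U (ARes A f a) (Res Y f x)"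
    and act_one: "U \<in> Ob S \<Longrightarrow> x \<in> Sec Y U \<Longrightarrow> act U \<one>\<^bsub>Grp A U\<^esub> x = x"
    and act_mult: "U \<in> Ob S \<Longrightarrow> a \<in> carrier (Grp A U) \<Longrightarrow> b \<in> carrier (Grp A U) \<Longrightarrow> x \<in> Sec Y U
      \<Longrightarrow> act U (a \<otimes>\<^bsub>Grp A U\<^esub> b) x = act U a (act U b x)"
    and simply_transitive: "U \<in> Ob S \<Longrightarrow> x \<in> Sec Y U \<Longrightarrow> x' \<in> Sec Y U
      \<Longrightarrow> \<exists>!a. a \<in> carrier (Grp A U) \<and> act U a x = x'"
    and locally_nonempty: "U \<in> Ob S \<Longrightarrow> \<exists>R\<in>Cov S U. \<forall>f\<in>R. Sec Y (Dom S f) \<noteq> {}"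

text \<open>The family \<open>\<phi>\<close> is the underlying action of \<open>G\<close> on \<open>A\<close>. The morphisms \<open>lam g\<close> are not
  required to be multiplicative in \<open>g\<close>.\<close>

locale torsor_action = torsor S A Y act
  for S :: "('o, 'm, 'z) site_scheme" and A :: "('o, 'm, 'a) ab_presheaf"
    and Y :: "('o, 'm, 'y) presheaf" and act :: "'o \<Rightarrow> 'a \<Rightarrow> 'y \<Rightarrow> 'y" +
  fixes G :: "('g, 'k) monoid_scheme"
    and \<phi> :: "'g \<Rightarrow> 'o \<Rightarrow> 'a \<Rightarrow> 'a"
    and lam :: "'g \<Rightarrow> 'o \<Rightarrow> 'y \<Rightarrow> 'y"
  assumes lam_morphism: "g \<in> carrier G \<Longrightarrow> sheaf_morphism S Y Y (lam g)"
    and phi_automorphism: "g \<in> carrier G \<Longrightarrow> ab_sheaf_automorphism S A (\<phi> g)"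
    and lam_equivariant: "g \<in> carrier G \<Longrightarrow> U \<in> Ob S \<Longrightarrow> a \<in> carrier (Grp A U) \<Longrightarrow> x \<in> Sec Y U
      \<Longrightarrow> lam g U (act U a x) = act U (\<phi> g U a) (lam g U x)"
    and phi_mult: "g \<in> carrier G \<Longrightarrow> h \<in> carrier G \<Longrightarrow> U \<in> Ob S \<Longrightarrow> a \<in> carrier (Grp A U)
      \<Longrightarrow> \<phi> (g \<otimes>\<^bsub>G\<^esub> h) U a = \<phi> g U (\<phi> h U a)"

text \<open>The unique \<open>a \<in> A(X)\<close> with \<open>\<lambda>\<^sub>g \<circ> \<lambda>\<^sub>h = a \<cdot> \<lambda>\<^sub>g\<^sub>h\<close> as morphisms of sheaves; a global
  section acts on sections over \<open>U\<close> through its restriction along the arrow \<open>U \<rightarrow> X\<close>. For a torsor action, existence and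
  uniqueness of \<open>a\<close> follow from commutativity of \<open>A\<close> and gluing along a cover of \<open>X\<close> that
  trivializes the torsor.\<close>

definition assoc_cochain ::
    "('o, 'm, 'z) category_scheme \<Rightarrow> 'o \<Rightarrow> ('o, 'm, 'a) ab_presheaf \<Rightarrow> ('o, 'm, 'y) presheaf
      \<Rightarrow> ('o \<Rightarrow> 'a \<Rightarrow> 'y \<Rightarrow> 'y) \<Rightarrow> ('g, 'k) monoid_scheme \<Rightarrow> ('g \<Rightarrow> 'o \<Rightarrow> 'y \<Rightarrow> 'y)
      \<Rightarrow> 'g \<Rightarrow> 'g \<Rightarrow> 'a"
  where "assoc_cochain C X A Y act G lam g h =
    (THE a. a \<in> carrier (Grp A X) \<and>
      (\<forall>U\<in>Ob C. \<forall>p\<in>Hom C U X. \<forall>x\<in>Sec Y U.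
        lam g U (lam h U x) = act U (ARes A p a) (lam (g \<otimes>\<^bsub>G\<^esub> h) U x)))"

text \<open>Inhomogeneous cochains, with coefficients in a commutative group \<open>M\<close> on which \<open>G\<close> acts by
  \<open>\<alpha>\<close>. Additively, the coboundary reads
  \<open>g\<cdot>c(h,k) - c(gh,k) + c(g,hk) - c(g,h)\<close>.\<close>

definition coboundary2 ::
    "('g, 'k) monoid_scheme \<Rightarrow> ('a, 'l) monoid_scheme \<Rightarrow> ('g \<Rightarrow> 'a \<Rightarrow> 'a)
      \<Rightarrow> ('g \<Rightarrow> 'g \<Rightarrow> 'a) \<Rightarrow> 'g \<Rightarrow> 'g \<Rightarrow> 'g \<Rightarrow> 'a"
  where "coboundary2 G M \<alpha> c g h k =
    \<alpha> g (c h k) \<otimes>\<^bsub>M\<^esub> inv\<^bsub>M\<^esub> c (g \<otimes>\<^bsub>G\<^esub> h) k \<otimes>\<^bsub>M\<^esub> c g (h \<otimes>\<^bsub>G\<^esub> k) \<otimes>\<^bsub>M\<^esub> inv\<^bsub>M\<^esub> c g h"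

definition two_cocycle ::
    "('g, 'k) monoid_scheme \<Rightarrow> ('a, 'l) monoid_scheme \<Rightarrow> ('g \<Rightarrow> 'a \<Rightarrow> 'a)
      \<Rightarrow> ('g \<Rightarrow> 'g \<Rightarrow> 'a) \<Rightarrow> bool"
  where "two_cocycle G M \<alpha> c \<longleftrightarrow> c \<in> carrier G \<rightarrow> carrier G \<rightarrow> carrier M \<and>
    (\<forall>g\<in>carrier G. \<forall>h\<in>carrier G. \<forall>k\<in>carrier G. coboundary2 G M \<alpha> c g h k = \<one>\<^bsub>M\<^esub>)"

end

theory Submission
  imports Defs
begin

text \<open>On an object \<open>U\<close> with \<open>Y(U) \<noteq> \<emptyset>\<close>, equivariance and commutativity of \<open>A\<close> show that one
  section of \<open>A(U)\<close> relates \<open>\<lambda>\<^sub>g \<circ> \<lambda>\<^sub>h\<close> to \<open>\<lambda>\<^sub>g\<^sub>h\<close> on all of \<open>Y(U)\<close>. These sections are unique, hence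
  stable under restriction, and glue to the global section \<open>\<chi>(g,h)\<close>. Since \<open>A\<close> acts freely,
  comparing the two bracketings of \<open>\<lambda>\<^sub>g \<circ> \<lambda>\<^sub>h \<circ> \<lambda>\<^sub>k\<close> over the objects on which \<open>Y\<close> has sections gives
  \<open>g\<cdot>\<chi>(h,k) + \<chi>(g,hk) = \<chi>(g,h) + \<chi>(gh,k)\<close> locally, and therefore globally.\<close>

section \<open>Morphisms, pullback squares and separatedness of sheaves\<close>

lemma (in category) Hom_Ob:
  assumes "f \<in> Hom C U V"
  shows "U \<in> Ob C" "V \<in> Ob C"
  using assms dom_closed cod_closed by (auto simp: Hom_def)

lemma sheaf_morphism_closed:
  assumes "sheaf_morphism C F F' t" "U \<in> Ob C" "x \<in> Sec F U"
  shows "t U x \<in> Sec F' U"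
  using assms by (auto simp: sheaf_morphism_def)

lemma sheaf_morphism_natural:
  assumes "sheaf_morphism C F F' t" "f \<in> Hom C U V" "x \<in> Sec F V"
  shows "Res F' f (t V x) = t U (Res F f x)"
  using assms by (auto simp: sheaf_morphism_def Hom_def)

lemma is_pullback_Hom:
  assumes "is_pullback C f g p q"
  shows "p \<in> Hom C (Dom C p) (Dom C f)" "q \<in> Hom C (Dom C p) (Dom C g)"
    "Comp C f p = Comp C g q"
  using assms by (auto simp: is_pullback_def commuting_square_def Hom_def)

text \<open>The uniqueness half of \<open>glue\<close>. The restrictions of \<open>x\<close> form a
  compatible family because pullback squares commute, and both \<open>x\<close> and \<open>y\<close>
  glue this family.\<close>

lemma (in sheaf) separated:
  assumes "site S" and U: "U \<in> Ob S" "R \<in> Cov S U"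
    and x: "x \<in> Sec F U" and y: "y \<in> Sec F U"
    and eq: "\<And>f. f \<in> R \<Longrightarrow> Res F f x = Res F f y"
  shows "x = y"
proof -
  interpret site S by fact
  have R: "f \<in> Hom S (Dom S f) U" if "f \<in> R" for f
    using cov_arrows[OF U that] by (simp add: Hom_def)
  have "Res F p (Res F f x) = Res F q (Res F g x)"
    if "f \<in> R" "g \<in> R" "is_pullback S f g p q" for f g p q
    using res_comp[OF is_pullback_Hom(1)[OF that(3)] R[OF that(1)] x]
      res_comp[OF is_pullback_Hom(2)[OF that(3)] R[OF that(2)] x] is_pullback_Hom(3)[OF that(3)]
    by simp
  then have "compatible_family S F R (\<lambda>f. Res F f x)"
    unfolding compatible_family_def using res_closed[OF R x] by blast
  from glue[OF U this] obtain t
    where t: "\<And>z. z \<in> Sec F U \<Longrightarrow> \<forall>f\<in>R. Res F f z = Res F f x \<Longrightarrow> z = t"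
    by blast
  have "x = t"
    using x by (rule t) simp
  moreover have "y = t"
    using y by (rule t) (simp add: eq)
  ultimately show ?thesis
    by simp
qed

section \<open>Testing and gluing sections of \<open>A\<close> where the torsor has sections\<close>

locale torsor_on_site = site S + torsor S A Y act
  for S :: "('o, 'm, 'z) site_scheme" and A :: "('o, 'm, 'a) ab_presheaf"
    and Y :: "('o, 'm, 'y) presheaf" and act :: "'o \<Rightarrow> 'a \<Rightarrow> 'y \<Rightarrow> 'y"
begin

lemma ARes_closed: "f \<in> Hom S U V \<Longrightarrow> a \<in> carrier (Grp A V) \<Longrightarrow> ARes A f a \<in> carrier (Grp A U)"
  using A.res_closed[of f U V a] by (simp add: underlying_def)

lemma ARes_comp:
  "f \<in> Hom S U V \<Longrightarrow> g \<in> Hom S V W \<Longrightarrow> a \<in> carrier (Grp A W)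
    \<Longrightarrow> ARes A (Comp S g f) a = ARes A f (ARes A g a)"
  using A.res_comp[of f U V g W a] by (simp add: underlying_def)

lemma ARes_separated:
  assumes "U \<in> Ob S" "R \<in> Cov S U" "a \<in> carrier (Grp A U)" "b \<in> carrier (Grp A U)"
    and "\<And>f. f \<in> R \<Longrightarrow> ARes A f a = ARes A f b"
  shows "a = b"
  using A.separated[OF site_axioms assms(1,2), of a b] assms(3-) by (simp add: underlying_def)

lemma act_cancel:
  assumes "U \<in> Ob S" "a \<in> carrier (Grp A U)" "b \<in> carrier (Grp A U)" "x \<in> Sec Y U"
    and "act U a x = act U b x"
  shows "a = b"
  using simply_transitive[OF assms(1,4) act_closed[OF assms(1,2,4)]] assms by metis

text \<open>The free action says something about \<open>A\<close> only over objects where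
  \<open>Y\<close> has a section. Such objects cover \<open>U\<close>, so separatedness of
  \<open>A\<close> makes it enough to compare there.\<close>

lemma section_eqI:
  assumes U: "U \<in> Ob S" and a: "a \<in> carrier (Grp A U)" and b: "b \<in> carrier (Grp A U)"
    and eq: "\<And>V f. f \<in> Hom S V U \<Longrightarrow> Sec Y V \<noteq> {} \<Longrightarrow> ARes A f a = ARes A f b"
  shows "a = b"
proof -
  obtain R where R: "R \<in> Cov S U" "\<forall>f\<in>R. Sec Y (Dom S f) \<noteq> {}"
    using locally_nonempty[OF U] by blast
  show ?thesis
  proof (rule ARes_separated[OF U R(1) a b])
    fix f assume "f \<in> R"
    then show "ARes A f a = ARes A f b"
      using cov_arrows[OF U R(1)] R(2) by (intro eq[of f "Dom S f"]) (auto simp: Hom_def)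
  qed
qed

text \<open>A cover of \<open>X\<close> trivializing \<open>Y\<close> yields \<open>t\<close> by
  gluing. That \<open>t\<close> restricts correctly along every other arrow into \<open>X\<close>,
  and not just along members of the cover, is checked on the pulled-back cover.\<close>

lemma glue_local_sections:
  assumes X: "X \<in> Ob S"
    and c: "\<And>U. U \<in> Ob S \<Longrightarrow> Sec Y U \<noteq> {} \<Longrightarrow> c U \<in> carrier (Grp A U)"
    and nat: "\<And>f U V. f \<in> Hom S U V \<Longrightarrow> Sec Y V \<noteq> {} \<Longrightarrow> ARes A f (c V) = c U"
  obtains t where "t \<in> carrier (Grp A X)"
    and "\<And>p U. p \<in> Hom S U X \<Longrightarrow> Sec Y U \<noteq> {} \<Longrightarrow> ARes A p t = c U"
proof -
  obtain R where R: "R \<in> Cov S X" and ne: "\<And>f. f \<in> R \<Longrightarrow> Sec Y (Dom S f) \<noteq> {}"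
    using locally_nonempty[OF X] by blast
  have RH: "f \<in> Hom S (Dom S f) X" if "f \<in> R" for f
    using cov_arrows[OF X R that] by (simp add: Hom_def)
  have "ARes A p (c (Dom S f)) = ARes A q (c (Dom S g))"
    if "f \<in> R" "g \<in> R" "is_pullback S f g p q" for f g p q
    using nat[OF is_pullback_Hom(1)[OF that(3)] ne[OF that(1)]]
      nat[OF is_pullback_Hom(2)[OF that(3)] ne[OF that(2)]] by simp
  then have "compatible_family S (underlying A) R (\<lambda>f. c (Dom S f))"
    using c[OF Hom_Ob(1)[OF RH] ne] by (auto simp: compatible_family_def underlying_def)
  from A.glue[OF X R this] obtain t where t: "t \<in> carrier (Grp A X)"
    and tR: "\<And>f. f \<in> R \<Longrightarrow> ARes A f t = c (Dom S f)"
    by (auto simp: underlying_def)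
  have "ARes A r t = c U" if r: "r \<in> Hom S U X" and U: "Sec Y U \<noteq> {}" for r U
  proof -
    obtain p q where pq: "\<And>f. f \<in> R \<Longrightarrow> is_pullback S f r (p f) (q f)"
      using cov_pullback_ex[OF X R r] by metis
    have UO: "U \<in> Ob S"
      using Hom_Ob(1)[OF r] .
    show ?thesis
    \<comment> \<open>The base change of \<open>R\<close> along \<open>r\<close> covers
      \<open>U\<close>, so both sections of \<open>A\<close> over \<open>U\<close> may be compared
      on it.\<close>
    proof (rule ARes_separated[OF UO cov_pullback[OF X R r pq]])
      show "ARes A r t \<in> carrier (Grp A U)" "c U \<in> carrier (Grp A U)"
        using ARes_closed[OF r t] c[OF UO U] by auto
    next
      fix k assume "k \<in> q ` R"
      then obtain f where f: "f \<in> R" "k = q f"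
        by blast
      let ?P = "Dom S (p f)"
      have p: "p f \<in> Hom S ?P (Dom S f)" and q: "q f \<in> Hom S ?P U"
        and sq: "Comp S f (p f) = Comp S r (q f)"
        using is_pullback_Hom[OF pq[OF f(1)]] r by (auto simp: Hom_def)
      \<comment> \<open>The restriction of \<open>t\<close> is known only along members of
        \<open>R\<close>; the pullback square trades the route through \<open>r\<close> for the one
        through \<open>f\<close>.\<close>
      have "ARes A (q f) (ARes A r t) = ARes A (p f) (ARes A f t)"
        using ARes_comp[OF q r t] ARes_comp[OF p RH[OF f(1)] t] sq by simp
      also have "\<dots> = c ?P"
        using nat[OF p ne[OF f(1)]] tR[OF f(1)] by simp
      also have "\<dots> = ARes A (q f) (c U)"
        using nat[OF q U] by simp
      finally show "ARes A k (ARes A r t) = ARes A k (c U)"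
        using f(2) by simp
    qed
  qed
  with t show thesis
    by (rule that)
qed

end

section \<open>The 2-cochain of an action on a torsor\<close>

locale torsor_action_on_site =
  torsor_on_site S A Y act + torsor_action S A Y act G \<phi> lam + G: monoid G
  for S :: "('o, 'm, 'z) site_scheme" and A :: "('o, 'm, 'a) ab_presheaf"
    and Y :: "('o, 'm, 'y) presheaf" and act :: "'o \<Rightarrow> 'a \<Rightarrow> 'y \<Rightarrow> 'y"
    and G :: "('g, 'k) monoid_scheme"
    and \<phi> :: "'g \<Rightarrow> 'o \<Rightarrow> 'a \<Rightarrow> 'a" and lam :: "'g \<Rightarrow> 'o \<Rightarrow> 'y \<Rightarrow> 'y"
begin

lemma lam_closed: "g \<in> carrier G \<Longrightarrow> U \<in> Ob S \<Longrightarrow> x \<in> Sec Y U \<Longrightarrow> lam g U x \<in> Sec Y U"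
  by (rule sheaf_morphism_closed[OF lam_morphism])

lemma lam_natural:
  "g \<in> carrier G \<Longrightarrow> f \<in> Hom S U V \<Longrightarrow> x \<in> Sec Y V \<Longrightarrow> Res Y f (lam g V x) = lam g U (Res Y f x)"
  by (rule sheaf_morphism_natural[OF lam_morphism])

lemma phi_morphism: "g \<in> carrier G \<Longrightarrow> sheaf_morphism S (underlying A) (underlying A) (\<phi> g)"
  using phi_automorphism unfolding ab_sheaf_automorphism_def ab_sheaf_morphism_def by blast

lemma phi_closed:
  "g \<in> carrier G \<Longrightarrow> U \<in> Ob S \<Longrightarrow> a \<in> carrier (Grp A U) \<Longrightarrow> \<phi> g U a \<in> carrier (Grp A U)"
  using sheaf_morphism_closed[OF phi_morphism, of g U a] by (simp add: underlying_def)

lemma phi_natural: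
  "g \<in> carrier G \<Longrightarrow> f \<in> Hom S U V \<Longrightarrow> a \<in> carrier (Grp A V)
    \<Longrightarrow> ARes A f (\<phi> g V a) = \<phi> g U (ARes A f a)"
  using sheaf_morphism_natural[OF phi_morphism, of g f U V a] by (simp add: underlying_def)

text \<open>One section \<open>x\<close> determines \<open>a\<close> by simple transitivity. Any
  other section is a translate of \<open>x\<close> by some \<open>b\<close>; then both sides are
  translated by the image of \<open>b\<close> under \<open>\<phi>\<close> of the product, which
  commutes with \<open>a\<close>.\<close>

lemma local_cochain_ex:
  assumes g: "g \<in> carrier G" and h: "h \<in> carrier G" and U: "U \<in> Ob S"
  obtains a where "a \<in> carrier (Grp A U)"
    and "\<And>x. x \<in> Sec Y U \<Longrightarrow> lam g U (lam h U x) = act U a (lam (g \<otimes>\<^bsub>G\<^esub> h) U x)"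
proof (cases "Sec Y U = {}")
  case True
  interpret AU: comm_group "Grp A U"
    using A.grp[OF U] .
  \<comment> \<open>With no sections the relation is vacuous. The neutral element is a default that
    gives every object a value.\<close>
  show thesis
    using that[of "\<one>\<^bsub>Grp A U\<^esub>"] True by simp
next
  case False
  interpret AU: comm_group "Grp A U"
    using A.grp[OF U] .
  from False obtain x where x: "x \<in> Sec Y U"
    by blast
  note gh = G.m_closed[OF g h]
  note lx = lam_closed[OF gh U x] lam_closed[OF h U x]
  obtain a where a: "a \<in> carrier (Grp A U)"
    and ax: "act U a (lam (g \<otimes>\<^bsub>G\<^esub> h) U x) = lam g U (lam h U x)"
    using simply_transitive[OF U lam_closed[OF gh U x] lam_closed[OF g U lam_closed[OF h U x]]] by blast
  have "lam g U (lam h U y) = act U a (lam (g \<otimes>\<^bsub>G\<^esub> h) U y)" if y: "y \<in> Sec Y U" for y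
  proof -
    obtain b where b: "b \<in> carrier (Grp A U)" and y: "y = act U b x"
      using simply_transitive[OF U x y] by blast
    let ?b = "\<phi> (g \<otimes>\<^bsub>G\<^esub> h) U b"
    have bc: "?b \<in> carrier (Grp A U)"
      using phi_closed[OF gh U b] .
    have "lam g U (lam h U y) = act U ?b (lam g U (lam h U x))"
      using lam_equivariant[OF h U b x] lam_equivariant[OF g U phi_closed[OF h U b] lx(2)]
      by (simp add: y phi_mult[OF g h U b])
    also have "\<dots> = act U (?b \<otimes>\<^bsub>Grp A U\<^esub> a) (lam (g \<otimes>\<^bsub>G\<^esub> h) U x)"
      using act_mult[OF U bc a lx(1)] ax by simp
    \<comment> \<open>Commutativity of \<open>A\<close> is what makes \<open>a\<close> independent
      of the chosen section.\<close>
    also have "\<dots> = act U a (act U ?b (lam (g \<otimes>\<^bsub>G\<^esub> h) U x))"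
      using act_mult[OF U a bc lx(1)] AU.m_comm[OF a bc] by simp
    also have "\<dots> = act U a (lam (g \<otimes>\<^bsub>G\<^esub> h) U y)"
      using lam_equivariant[OF gh U b x] by (simp add: y)
    finally show ?thesis .
  qed
  with a show thesis
    by (rule that)
qed

text \<open>This makes the definite description in \<open>assoc_cochain\<close> meaningful.
  Existence comes from gluing the local sections, uniqueness from freeness of the action over
  objects where \<open>Y\<close> has sections.\<close>

lemma global_cochain_ex1:
  assumes g: "g \<in> carrier G" and h: "h \<in> carrier G" and X: "X \<in> Ob S"
  shows "\<exists>!a. a \<in> carrier (Grp A X) \<and>
    (\<forall>U\<in>Ob S. \<forall>p\<in>Hom S U X. \<forall>x\<in>Sec Y U.
      lam g U (lam h U x) = act U (ARes A p a) (lam (g \<otimes>\<^bsub>G\<^esub> h) U x))"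
proof -
  note gh = G.m_closed[OF g h]
  obtain c where c: "\<And>U. U \<in> Ob S \<Longrightarrow> c U \<in> carrier (Grp A U)"
    and cx: "\<And>U x. U \<in> Ob S \<Longrightarrow> x \<in> Sec Y U
      \<Longrightarrow> lam g U (lam h U x) = act U (c U) (lam (g \<otimes>\<^bsub>G\<^esub> h) U x)"
  proof -
    have "\<exists>a. a \<in> carrier (Grp A U) \<and> (\<forall>x\<in>Sec Y U.
        lam g U (lam h U x) = act U a (lam (g \<otimes>\<^bsub>G\<^esub> h) U x))" if "U \<in> Ob S" for U
      using local_cochain_ex[OF g h that] by metis
    then show thesis
      using that by metis
  qed
  \<comment> \<open>The restriction of \<open>c V\<close> satisfies the relation that characterizes
    \<open>c U\<close>, and freeness forces equality. Where \<open>Y\<close> has no section,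
    \<open>c V\<close> is arbitrary; hence the condition \<open>ne\<close>.\<close>
  have nat: "ARes A f (c V) = c U" if f: "f \<in> Hom S U V" and ne: "Sec Y V \<noteq> {}" for f U V
  proof -
    obtain x where x: "x \<in> Sec Y V"
      using ne by blast
    note U = Hom_Ob(1)[OF f] and V = Hom_Ob(2)[OF f]
    note rx = Y.res_closed[OF f x]
    have "act U (ARes A f (c V)) (lam (g \<otimes>\<^bsub>G\<^esub> h) U (Res Y f x))
        = Res Y f (act V (c V) (lam (g \<otimes>\<^bsub>G\<^esub> h) V x))"
      using act_natural[OF f c[OF V] lam_closed[OF gh V x]] lam_natural[OF gh f x] by simp
    also have "\<dots> = Res Y f (lam g V (lam h V x))"
      using cx[OF V x] by simp
    also have "\<dots> = lam g U (lam h U (Res Y f x))"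
      using lam_natural[OF g f lam_closed[OF h V x]] lam_natural[OF h f x] by simp
    also have "\<dots> = act U (c U) (lam (g \<otimes>\<^bsub>G\<^esub> h) U (Res Y f x))"
      using cx[OF U rx] .
    finally show ?thesis
      by (rule act_cancel[OF U ARes_closed[OF f c[OF V]] c[OF U] lam_closed[OF gh U rx]])
  qed
  obtain t where t: "t \<in> carrier (Grp A X)"
    and tp: "\<And>p U. p \<in> Hom S U X \<Longrightarrow> Sec Y U \<noteq> {} \<Longrightarrow> ARes A p t = c U"
    by (rule glue_local_sections[OF X, of c]; rule c nat that; assumption)
  show ?thesis
  proof (rule ex1I[of _ t])
    show "t \<in> carrier (Grp A X) \<and>
      (\<forall>U\<in>Ob S. \<forall>p\<in>Hom S U X. \<forall>x\<in>Sec Y U.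
        lam g U (lam h U x) = act U (ARes A p t) (lam (g \<otimes>\<^bsub>G\<^esub> h) U x))"
    proof (intro conjI ballI)
      fix U p x
      assume U: "U \<in> Ob S" and p: "p \<in> Hom S U X" and x: "x \<in> Sec Y U"
      then have "ARes A p t = c U"
        by (intro tp) auto
      then show "lam g U (lam h U x) = act U (ARes A p t) (lam (g \<otimes>\<^bsub>G\<^esub> h) U x)"
        using cx[OF U x] by simp
    qed (rule t)
  next
    fix a
    assume a: "a \<in> carrier (Grp A X) \<and>
      (\<forall>U\<in>Ob S. \<forall>p\<in>Hom S U X. \<forall>x\<in>Sec Y U.
        lam g U (lam h U x) = act U (ARes A p a) (lam (g \<otimes>\<^bsub>G\<^esub> h) U x))"
    show "a = t"
    proof (rule section_eqI[OF X])
      show "a \<in> carrier (Grp A X)" "t \<in> carrier (Grp A X)"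
        using a t by auto
    next
      fix V f
      assume f: "f \<in> Hom S V X" and ne: "Sec Y V \<noteq> {}"
      then obtain x where x: "x \<in> Sec Y V"
        by blast
      note V = Hom_Ob(1)[OF f]
      have "act V (ARes A f a) (lam (g \<otimes>\<^bsub>G\<^esub> h) V x) = act V (c V) (lam (g \<otimes>\<^bsub>G\<^esub> h) V x)"
        using a V f x by (simp flip: cx)
      then have "ARes A f a = c V"
        using act_cancel[OF V ARes_closed[OF f] c[OF V] lam_closed[OF gh V x]] a by blast
      then show "ARes A f a = ARes A f t"
        using tp[OF f ne] by simp
    qed
  qed
qed

lemma
  assumes "g \<in> carrier G" "h \<in> carrier G" "X \<in> Ob S"
  shows assoc_cochain_closed: "assoc_cochain S X A Y act G lam g h \<in> carrier (Grp A X)"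
    and lam_lam: "p \<in> Hom S U X \<Longrightarrow> x \<in> Sec Y U \<Longrightarrow> lam g U (lam h U x)
      = act U (ARes A p (assoc_cochain S X A Y act G lam g h)) (lam (g \<otimes>\<^bsub>G\<^esub> h) U x)"
  using theI'[OF global_cochain_ex1[OF assms], folded assoc_cochain_def] Hom_Ob(1) by blast+

text \<open>The cocycle identity with the negative terms moved to the other side, the form in which
  it comes out of associativity of composition.\<close>

lemma assoc_cochain_cocycle:
  assumes g: "g \<in> carrier G" and h: "h \<in> carrier G" and k: "k \<in> carrier G" and X: "X \<in> Ob S"
  defines "c \<equiv> assoc_cochain S X A Y act G lam"
  shows "\<phi> g X (c h k) \<otimes>\<^bsub>Grp A X\<^esub> c g (h \<otimes>\<^bsub>G\<^esub> k) = c g h \<otimes>\<^bsub>Grp A X\<^esub> c (g \<otimes>\<^bsub>G\<^esub> h) k"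
proof -
  interpret AX: comm_group "Grp A X"
    using A.grp[OF X] .
  note gh = G.m_closed[OF g h] and hk = G.m_closed[OF h k]
  note ghk = G.m_closed[OF gh k]
  have c: "c a b \<in> carrier (Grp A X)" if "a \<in> carrier G" "b \<in> carrier G" for a b
    using assoc_cochain_closed[OF that X] by (simp add: c_def)
  have ll: "lam a U (lam b U x) = act U (ARes A p (c a b)) (lam (a \<otimes>\<^bsub>G\<^esub> b) U x)"
    if "a \<in> carrier G" "b \<in> carrier G" "p \<in> Hom S U X" "x \<in> Sec Y U" for a b p U x
    using lam_lam[OF that(1,2) X that(3,4)] by (simp add: c_def)
  show ?thesis
  proof (rule section_eqI[OF X])
    show "\<phi> g X (c h k) \<otimes>\<^bsub>Grp A X\<^esub> c g (h \<otimes>\<^bsub>G\<^esub> k) \<in> carrier (Grp A X)"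
      "c g h \<otimes>\<^bsub>Grp A X\<^esub> c (g \<otimes>\<^bsub>G\<^esub> h) k \<in> carrier (Grp A X)"
      using c g h k gh hk phi_closed[OF g X] by auto
  next
    fix U p
    assume p: "p \<in> Hom S U X" and "Sec Y U \<noteq> {}"
    then obtain x where x: "x \<in> Sec Y U"
      by blast
    note U = Hom_Ob(1)[OF p]
    interpret AU: comm_group "Grp A U"
      using A.grp[OF U] .
    let ?c = "\<lambda>a b. ARes A p (c a b)"
    let ?z = "lam (g \<otimes>\<^bsub>G\<^esub> h \<otimes>\<^bsub>G\<^esub> k) U x"
    note rc = ARes_closed[OF p c]
    note z = lam_closed[OF ghk U x]
    \<comment> \<open>Inner pair first: moving the value at \<open>(h, k)\<close> out past
      \<open>lam g\<close> twists it by \<open>\<phi> g\<close>, by equivariance.\<close>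
    have L: "lam g U (lam h U (lam k U x)) = act U (\<phi> g U (?c h k) \<otimes>\<^bsub>Grp A U\<^esub> ?c g (h \<otimes>\<^bsub>G\<^esub> k)) ?z"
    proof -
      have "lam g U (lam h U (lam k U x)) = act U (\<phi> g U (?c h k)) (lam g U (lam (h \<otimes>\<^bsub>G\<^esub> k) U x))"
        using ll[OF h k p x] lam_equivariant[OF g U rc[OF h k] lam_closed[OF hk U x]] by simp
      also have "\<dots> = act U (\<phi> g U (?c h k)) (act U (?c g (h \<otimes>\<^bsub>G\<^esub> k)) ?z)"
        using ll[OF g hk p x] G.m_assoc[OF g h k] by simp
      finally show ?thesis
        using act_mult[OF U phi_closed[OF g U rc[OF h k]] rc[OF g hk] z] by simp
    qed
    \<comment> \<open>Outer pair first: the relation for \<open>g\<close> and \<open>h\<close> is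
      applied to the section \<open>lam k U x\<close>, so no twist appears.\<close>
    have R: "lam g U (lam h U (lam k U x)) = act U (?c g h \<otimes>\<^bsub>Grp A U\<^esub> ?c (g \<otimes>\<^bsub>G\<^esub> h) k) ?z"
      using ll[OF g h p lam_closed[OF k U x]] ll[OF gh k p x]
        act_mult[OF U rc[OF g h] rc[OF gh k] z] by simp
    have "\<phi> g U (?c h k) \<otimes>\<^bsub>Grp A U\<^esub> ?c g (h \<otimes>\<^bsub>G\<^esub> k) = ?c g h \<otimes>\<^bsub>Grp A U\<^esub> ?c (g \<otimes>\<^bsub>G\<^esub> h) k"
      using act_cancel[OF U _ _ z] L R rc g h k gh hk phi_closed[OF g U] by (metis AU.m_closed)
    \<comment> \<open>Restriction is a homomorphism and commutes with \<open>\<phi> g\<close>, so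
      the identity over \<open>U\<close> is the restriction of the one over
      \<open>X\<close>.\<close>
    then show "ARes A p (\<phi> g X (c h k) \<otimes>\<^bsub>Grp A X\<^esub> c g (h \<otimes>\<^bsub>G\<^esub> k))
        = ARes A p (c g h \<otimes>\<^bsub>Grp A X\<^esub> c (g \<otimes>\<^bsub>G\<^esub> h) k)"
      using hom_mult[OF A.res_hom[OF p]] c g h k gh hk phi_closed[OF g X] phi_natural[OF g p]
      by simp
  qed
qed

end

section \<open>Vanishing of the coboundary\<close>

theorem proposition4p11:
  fixes S :: "('o, 'm, 'z) site_scheme" and X :: 'o
    and A :: "('o, 'm, 'a) ab_presheaf" and Y :: "('o, 'm, 'y) presheaf"
    and act :: "'o \<Rightarrow> 'a \<Rightarrow> 'y \<Rightarrow> 'y"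
    and G :: "('g, 'k) monoid_scheme"
    and \<phi> :: "'g \<Rightarrow> 'o \<Rightarrow> 'a \<Rightarrow> 'a"
    and lam :: "'g \<Rightarrow> 'o \<Rightarrow> 'y \<Rightarrow> 'y"
  assumes "site S" and "final_object S X"
    and "abelian_sheaf S A"
    and "group G" and "finite (carrier G)"
    and "torsor S A Y act"
    and "torsor_action S A Y act G \<phi> lam"
  shows "two_cocycle G (Grp A X) (\<lambda>g. \<phi> g X) (assoc_cochain S X A Y act G lam)"
proof -
  interpret site S by fact
  interpret torsor_action S A Y act G \<phi> lam by fact
  interpret G: group G by fact
  interpret torsor_action_on_site S A Y act G \<phi> lam ..
  have X: "X \<in> Ob S"
    using assms(2) by (simp add: final_object_def)
  interpret AX: comm_group "Grp A X"
    using A.grp[OF X] .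
  let ?c = "assoc_cochain S X A Y act G lam"
  have "coboundary2 G (Grp A X) (\<lambda>g. \<phi> g X) ?c g h k = \<one>\<^bsub>Grp A X\<^esub>"
    if g: "g \<in> carrier G" and h: "h \<in> carrier G" and k: "k \<in> carrier G" for g h k
  proof -
    note gh = G.m_closed[OF g h] and hk = G.m_closed[OF h k]
    note c = assoc_cochain_closed[OF _ _ X]
    note cs = phi_closed[OF g X c[OF h k]] c[OF gh k] c[OF g hk] c[OF g h]
    \<comment> \<open>Collecting the two positive and the two inverted terms turns the coboundary
      into the quotient of the two sides of \<open>assoc_cochain_cocycle\<close>.\<close>
    have "coboundary2 G (Grp A X) (\<lambda>g. \<phi> g X) ?c g h k
        = (\<phi> g X (?c h k) \<otimes>\<^bsub>Grp A X\<^esub> ?c g (h \<otimes>\<^bsub>G\<^esub> k))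
          \<otimes>\<^bsub>Grp A X\<^esub> inv\<^bsub>Grp A X\<^esub> (?c g h \<otimes>\<^bsub>Grp A X\<^esub> ?c (g \<otimes>\<^bsub>G\<^esub> h) k)"
      using cs by (simp add: coboundary2_def AX.inv_mult AX.m_ac)
    also have "\<dots> = \<one>\<^bsub>Grp A X\<^esub>"
      using assoc_cochain_cocycle[OF g h k X] cs by simp
    finally show ?thesis .
  qed
  then show ?thesis
    using assoc_cochain_closed[OF _ _ X] by (auto simp: two_cocycle_def)
qed

end
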